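(* Let $\mathcal S,\mathcal B\subset\mathbb R^p$ be bounded closed convex polytopes with non-empty interior. The inner approximation algorithm with initial approximation $\mathcal S$, using a weak plane separating oracle $\mathsf{hpO}^*(\mathcal B)$ for $\mathcal B$, terminates with $\mathcal R=\mathsf{conv}(\mathcal B\cup\mathcal S)$, the convex hull of $\mathcal B$ and $\mathcal S$. The algorithm makes at most $2^v+f$ oracle calls, where $v$ is the number of vertices of $\mathcal B$ and $f$ is the number of facets of $\mathcal R$.
   Context: A halfspace in $\mathbb R^p$ is a set $H=\{y\in\mathbb R^p: yh\ge M\}$, where $h\in\mathbb R^p$ is a non-null vector, $M\in\mathbb R$, and $yh$ is the inner product. The negative side of $H$ is the open halfspace $\{y: yh<M\}$. A facet of a full-dimensional polytope in $\mathbb R^p$ is a face of dimension $p-1$; each facet is identified with the halfspace which contains the polytope and whose bounding hyperplane intersects the polytope in that facet. Weak plane separating oracle $\mathsf{hpO}^*(\mathcal B)$: a black box which on input a halfspace $H\subset\mathbb R^p$ returns "inside" if $\mathcal B\subseteq H$; otherwise it returns a boundary point $v$ of $\mathcal B$ on the negative side of $H$ which is farthest away from the bounding hyperplane of $H$ (farthest among the points of $\mathcal B$ on the negative side; any such point is an allowed answer). Inner approximation algorithm: Set $\mathcal S_0=\mathcal S$. In each approximation certain facets are marked "final"; initially no facet is marked. Consider the $i$-th approximation $\mathcal S_i$. If all facets of $\mathcal S_i$ are final, stop with result $\mathcal R=\mathcal S_i$. Otherwise pick any non-final facet $H_i$ of $\mathcal S_i$ and call the oracle with (the halfspace corresponding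 to) $H_i$. If the oracle returns "inside", mark $H_i$ as final and repeat. Otherwise the oracle returns a boundary point $v_i$ of $\mathcal B$ on the negative side of $H_i$; let $\mathcal S_{i+1}$ be the convex hull of $\mathcal S_i$ and $v_i$, keep the "final" flag on previous facets, and repeat. The statement holds for every choice of the picked facets and for all admissible oracle answers. *)

theory Defs
  imports "HOL-Analysis.Analysis"
begin

text \<open>Halfspaces are point sets rather than pairs \<open>(h, M)\<close>: rescaling the pair gives the same
  halfspace, and a facet must correspond to exactly one halfspace.\<close>

definition halfspace :: "'a::euclidean_space set \<Rightarrow> bool" where
  "halfspace H \<longleftrightarrow> (\<exists>h M. h \<noteq> 0 \<and> H = {y. y \<bullet> h \<ge> M})"

definition negative_side :: "'a::euclidean_space set \<Rightarrow> 'a set" where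
  "negative_side H = - H"

definition bounding_hyperplane :: "'a::euclidean_space set \<Rightarrow> 'a set" where
  "bounding_hyperplane H = frontier H"

lemma negative_side_halfspace: "negative_side {y. y \<bullet> h \<ge> M} = {y. y \<bullet> h < M}"
  by (auto simp: negative_side_def)

lemma bounding_hyperplane_halfspace:
  "h \<noteq> 0 \<Longrightarrow> bounding_hyperplane {y. y \<bullet> h \<ge> M} = {y. y \<bullet> h = M}"
  using frontier_halfspace_ge[of h M] by (simp add: bounding_hyperplane_def inner_commute)

definition facet_halfspaces :: "'a::euclidean_space set \<Rightarrow> 'a set set" where
  "facet_halfspaces P =
     {H. halfspace H \<and> P \<subseteq> H \<and> (P \<inter> bounding_hyperplane H) facet_of P}"

datatype 'a answer = Inside | Point 'a

text \<open>The oracle is a relation: \<open>hpO B H a\<close> says that \<open>a\<close> is an admissible answer to the query \<open>H\<close>.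
  Different calls with the same query may be answered differently.\<close>

fun hpO :: "'a::euclidean_space set \<Rightarrow> 'a set \<Rightarrow> 'a answer \<Rightarrow> bool" where
  "hpO B H Inside \<longleftrightarrow> B \<subseteq> H"
| "hpO B H (Point v) \<longleftrightarrow> \<not> B \<subseteq> H \<and> v \<in> frontier B \<and> v \<in> negative_side H \<and>
     (\<forall>y \<in> B \<inter> negative_side H.
        infdist y (bounding_hyperplane H) \<le> infdist v (bounding_hyperplane H))"

text \<open>A state consists of the current approximation and the set of halfspaces flagged as final.
  Each step makes exactly one oracle call.\<close>

inductive step ::
  "'a::euclidean_space set \<Rightarrow> 'a set \<times> 'a set set \<Rightarrow> 'a set \<times> 'a set set \<Rightarrow> bool"
  for B where
  mark_final: "H \<in> facet_halfspaces P \<Longrightarrow> H \<notin> Fin \<Longrightarrow> hpO B H Inside \<Longrightarrow>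
     step B (P, Fin) (P, insert H Fin)"
| extend: "H \<in> facet_halfspaces P \<Longrightarrow> H \<notin> Fin \<Longrightarrow> hpO B H (Point v) \<Longrightarrow>
     step B (P, Fin) (convex hull (insert v P), Fin)"

definition stopped :: "'a::euclidean_space set \<times> 'a set set \<Rightarrow> bool" where
  "stopped st \<longleftrightarrow> facet_halfspaces (fst st) \<subseteq> snd st"

text \<open>Termination for all choices of facets and all admissible answers: no run is infinite, and
  a run can get stuck only by stopping regularly.\<close>

definition terminates :: "'a::euclidean_space set \<Rightarrow> 'a set \<Rightarrow> bool" where
  "terminates B S \<longleftrightarrow>
     \<not> (\<exists>\<sigma>. \<sigma> 0 = (S, {}) \<and> (\<forall>i::nat. step B (\<sigma> i) (\<sigma> (Suc i)))) \<and>
     (\<forall>st. (step B)\<^sup>*\<^sup>* (S, {}) st \<and> \<not> stopped st \<longrightarrow> (\<exists>st'. step B st st'))"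

end

theory Submission
  imports Defs
begin

text \<open>Write \<open>v\<close> for the number of vertices of \<open>B\<close> and \<open>f\<close> for the number of facets of \<open>conv (B \<union> S)\<close>
  in \<open>p\<close>-dimensional space. Every oracle call either flags a facet or adds a point, so it is enough to bound the two kinds
  of calls separately by quantities that only depend on \<open>B\<close> and \<open>S\<close>.

  A halfspace \<open>H\<close> that gets flagged contains \<open>B\<close>, and it contains \<open>S\<close> because the approximation only
  grows; hence it contains \<open>conv (B \<union> S)\<close>. Its bounding hyperplane already meets the current
  approximation, a subset of this hull, in dimension \<open>p - 1\<close>, so \<open>H\<close> is a facet of the hull as well
  (\<open>facet_halfspaces_mono\<close>). Different facet halfspaces cut out different facets
  (\<open>inj_on_facet_halfspaces\<close>), hence at most \<open>f\<close> calls flag one.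

  A returned point \<open>x\<close> lies in the face of \<open>B\<close> that is farthest below the queried \<open>H\<close>, so it is a
  convex combination of vertices of \<open>B\<close> strictly below \<open>H\<close>. The convex hull of all those vertices misses
  the approximation before the call, which lies in \<open>H\<close>, and meets it in \<open>x\<close> afterwards
  (\<open>met_vertex_sets_extend\<close>). Therefore the number of sets of vertices of \<open>B\<close> whose hull meets the
  approximation grows with every point added, and there are at most \<open>2^v\<close> such calls. That number plus
  the number of flags is a measure that every step increases, which gives termination and the bound
  at once.

  When the algorithm stops, all facet halfspaces of the result \<open>R\<close> contain \<open>B\<close>. Since a
  full-dimensional polytope is the intersection of its facet halfspaces
  (\<open>Inter_facet_halfspaces_subset\<close>), \<open>B \<subseteq> R\<close>; the reverse inclusion \<open>R \<subseteq> conv (B \<union> S)\<close> holds in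
  every approximation because only points of \<open>B\<close> are added.\<close>

section \<open>Halfspaces and the facets they cut out\<close>

lemma halfspaceE:
  assumes "halfspace H"
  obtains h M where "h \<noteq> 0" "H = {y. y \<bullet> h \<ge> M}" "bounding_hyperplane H = {y. y \<bullet> h = M}"
    "negative_side H = {y. y \<bullet> h < M}"
  using assms bounding_hyperplane_halfspace negative_side_halfspace
  unfolding halfspace_def by metis

text \<open>Turns the farthest-point requirement on the oracle into a statement about linear functionals.
  The distance is attained at the orthogonal projection, and Cauchy--Schwarz bounds it from below.\<close>

lemma infdist_hyperplane:
  fixes h :: "'a::euclidean_space"
  assumes "h \<noteq> 0"
  shows "infdist y {x. x \<bullet> h = M} = \<bar>y \<bullet> h - M\<bar> / norm h"
proof -
  define z where "z = y - ((y \<bullet> h - M) / (h \<bullet> h)) *\<^sub>R h"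
  have z: "z \<bullet> h = M"
    using assms by (simp add: z_def inner_diff_left)
  have dz: "dist y z = \<bar>y \<bullet> h - M\<bar> / norm h"
    using assms by (simp add: z_def dist_norm power2_norm_eq_inner[symmetric] power2_eq_square)
  have le: "\<bar>y \<bullet> h - M\<bar> / norm h \<le> dist y x" if "x \<bullet> h = M" for x
  proof -
    have "\<bar>y \<bullet> h - M\<bar> = \<bar>(y - x) \<bullet> h\<bar>"
      using that by (simp add: inner_diff_left)
    also have "\<dots> \<le> dist y x * norm h"
      using Cauchy_Schwarz_ineq2[of "y - x" h] by (simp add: dist_norm)
    finally show ?thesis
      using assms by (simp add: divide_le_eq)
  qed
  show ?thesis
  proof (rule antisym)
    show "infdist y {x. x \<bullet> h = M} \<le> \<bar>y \<bullet> h - M\<bar> / norm h"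
      using infdist_le[of z "{x. x \<bullet> h = M}" y] z dz by simp
    show "\<bar>y \<bullet> h - M\<bar> / norm h \<le> infdist y {x. x \<bullet> h = M}"
      using z le by (auto simp: infdist_def intro!: cINF_greatest)
  qed
qed

lemma aff_dim_hyperplane_inner:
  fixes h :: "'a::euclidean_space"
  assumes "h \<noteq> 0"
  shows "aff_dim {x. x \<bullet> h = M} = int (DIM('a)) - 1"
  using aff_dim_hyperplane[OF assms, of M] by (simp add: inner_commute)

lemma supporting_hyperplane_face:
  fixes P :: "'a::euclidean_space set"
  assumes "convex P" "\<And>x. x \<in> P \<Longrightarrow> x \<bullet> h \<ge> M"
  shows "(P \<inter> {x. x \<bullet> h = M}) face_of P"
  using face_of_Int_supporting_hyperplane_ge[of P M h] assms by (simp add: inner_commute)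

text \<open>The bounding hyperplane still supports the larger set, and the face it cuts out there is
  squeezed between the old facet and the hyperplane, both of dimension \<open>p - 1\<close>. This lets flagged
  halfspaces be counted as facets of the final hull, whatever approximation they were flagged in.\<close>

lemma facet_halfspaces_mono:
  fixes P Q :: "'a::euclidean_space set"
  assumes H: "H \<in> facet_halfspaces P" and "P \<subseteq> Q" "Q \<subseteq> H" "convex Q" "interior P \<noteq> {}"
  shows "H \<in> facet_halfspaces Q"
proof -
  from H have "halfspace H" and facet: "(P \<inter> bounding_hyperplane H) facet_of P"
    by (auto simp: facet_halfspaces_def)
  then obtain h M where h: "h \<noteq> 0" and H_eq: "H = {y. y \<bullet> h \<ge> M}"
    and bd: "bounding_hyperplane H = {y. y \<bullet> h = M}"
    using halfspaceE by metis
  have full: "aff_dim P = int (DIM('a))" "aff_dim Q = int (DIM('a))"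
    using assms interior_mono[OF \<open>P \<subseteq> Q\<close>] by (auto intro: aff_dim_nonempty_interior)
  have "Q \<inter> bounding_hyperplane H face_of Q"
    unfolding bd using assms H_eq by (intro supporting_hyperplane_face) auto
  moreover have sub: "P \<inter> bounding_hyperplane H \<subseteq> Q \<inter> bounding_hyperplane H"
    using assms by auto
  moreover have "P \<inter> bounding_hyperplane H \<noteq> {}"
    using facet by (simp add: facet_of_def)
  moreover have "aff_dim (Q \<inter> bounding_hyperplane H) = aff_dim Q - 1"
  proof (rule antisym)
    show "aff_dim (Q \<inter> bounding_hyperplane H) \<le> aff_dim Q - 1"
      using aff_dim_subset[of "Q \<inter> bounding_hyperplane H" "bounding_hyperplane H"]
      by (simp add: bd aff_dim_hyperplane_inner[OF h] full)
    show "aff_dim Q - 1 \<le> aff_dim (Q \<inter> bounding_hyperplane H)"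
      using aff_dim_subset[OF sub] facet by (simp add: facet_of_def full)
  qed
  ultimately have "(Q \<inter> bounding_hyperplane H) facet_of Q"
    by (auto simp: facet_of_def)
  with \<open>halfspace H\<close> \<open>Q \<subseteq> H\<close> show ?thesis
    by (simp add: facet_halfspaces_def)
qed

text \<open>A hyperplane bounds only two halfspaces, and \<open>p\<close> selects the side: a segment from \<open>p\<close> to a point
  outside the second halfspace would cross the common hyperplane while staying strictly inside
  the first one.\<close>

lemma halfspace_subset_if_same_hyperplane:
  fixes p :: "'a::euclidean_space"
  assumes hyp: "{y. y \<bullet> h = M} = {y. y \<bullet> h' = M'}"
    and "p \<bullet> h > M" "p \<bullet> h' > M'"
  shows "{y. y \<bullet> h \<ge> M} \<subseteq> {y. y \<bullet> h' \<ge> M'}"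
proof
  fix y assume y: "y \<in> {y. y \<bullet> h \<ge> M}"
  show "y \<in> {y. y \<bullet> h' \<ge> M'}"
  proof (rule ccontr)
    assume "y \<notin> {y. y \<bullet> h' \<ge> M'}"
    then have neg: "y \<bullet> h' < M'" by simp
    \<comment> \<open>the parameter at which the segment from \<open>y\<close> to \<open>p\<close> crosses the second hyperplane\<close>
    define t where "t = (M' - y \<bullet> h') / (p \<bullet> h' - y \<bullet> h')"
    have t: "0 < t" "t < 1"
      using neg assms(3) by (auto simp: t_def divide_less_eq)
    define z where "z = y + t *\<^sub>R (p - y)"
    have "z \<bullet> h' = y \<bullet> h' + t * (p \<bullet> h' - y \<bullet> h')"
      by (simp add: z_def inner_add_left inner_diff_left)
    also have "\<dots> = M'"
      using neg assms(3) by (simp add: t_def)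
    finally have "z \<bullet> h = M"
      using hyp by auto
    moreover have "z \<bullet> h = (1 - t) * (y \<bullet> h) + t * (p \<bullet> h)"
      by (simp add: z_def inner_add_left inner_diff_left algebra_simps)
    moreover have "(1 - t) * (y \<bullet> h) \<ge> (1 - t) * M" "t * (p \<bullet> h) > t * M"
      using t y assms(2) by auto
    ultimately show False
      by (simp add: algebra_simps)
  qed
qed

text \<open>A facet of a full-dimensional set spans its bounding hyperplane, and an interior point of the
  set decides which side of it is meant.\<close>

lemma inj_on_facet_halfspaces:
  fixes P :: "'a::euclidean_space set"
  assumes "interior P \<noteq> {}"
  shows "inj_on (\<lambda>H. P \<inter> bounding_hyperplane H) (facet_halfspaces P)"
proof (rule inj_onI)
  fix H H'
  assume H: "H \<in> facet_halfspaces P" and H': "H' \<in> facet_halfspaces P"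
    and same: "P \<inter> bounding_hyperplane H = P \<inter> bounding_hyperplane H'"
  obtain p where p: "p \<in> interior P" using assms by blast
  have full: "aff_dim P = int (DIM('a))"
    using assms by (rule aff_dim_nonempty_interior)
  have spanned: "affine hull (P \<inter> bounding_hyperplane G) = bounding_hyperplane G"
    and halfspace: "halfspace G" and contains: "P \<subseteq> G" if "G \<in> facet_halfspaces P" for G
  proof -
    from that show "halfspace G" "P \<subseteq> G" by (auto simp: facet_halfspaces_def)
    have facet: "(P \<inter> bounding_hyperplane G) facet_of P"
      using that by (simp add: facet_halfspaces_def)
    from \<open>halfspace G\<close> obtain h M where h: "h \<noteq> 0"
      and bd: "bounding_hyperplane G = {y. y \<bullet> h = M}" using halfspaceE by metis
    have aff: "affine (bounding_hyperplane G)"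
      using affine_hyperplane[of h M] by (simp add: bd inner_commute)
    show "affine hull (P \<inter> bounding_hyperplane G) = bounding_hyperplane G"
    proof (rule affine_dim_equal)
      show "affine hull (P \<inter> bounding_hyperplane G) \<subseteq> bounding_hyperplane G"
        by (rule hull_minimal) (use aff in auto)
      show "affine hull (P \<inter> bounding_hyperplane G) \<noteq> {}"
        using facet by (simp add: facet_of_def)
      show "aff_dim (affine hull (P \<inter> bounding_hyperplane G)) = aff_dim (bounding_hyperplane G)"
        using facet by (simp add: facet_of_def full bd aff_dim_hyperplane_inner[OF h])
    qed (use aff in auto)
  qed
  have inside: "p \<bullet> h > M" if "h \<noteq> 0" "P \<subseteq> {y. y \<bullet> h \<ge> M}" for h M
    using interior_mono[OF that(2)] p interior_halfspace_ge[OF that(1), of M]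
    by (auto simp: inner_commute)
  obtain h M where h: "h \<noteq> 0" "H = {y. y \<bullet> h \<ge> M}" "bounding_hyperplane H = {y. y \<bullet> h = M}"
    using halfspaceE[OF halfspace[OF H]] by metis
  obtain h' M' where h': "h' \<noteq> 0" "H' = {y. y \<bullet> h' \<ge> M'}"
    "bounding_hyperplane H' = {y. y \<bullet> h' = M'}"
    using halfspaceE[OF halfspace[OF H']] by metis
  have hyp: "{y. y \<bullet> h = M} = {y. y \<bullet> h' = M'}"
    using spanned[OF H] spanned[OF H'] same h(3) h'(3) by metis
  have "p \<bullet> h > M" "p \<bullet> h' > M'"
    using inside contains[OF H] contains[OF H'] h h' by auto
  then show "H = H'"
    unfolding h(2) h'(2) using hyp
    by (intro antisym halfspace_subset_if_same_hyperplane) auto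
qed

lemma finite_facet_halfspaces:
  assumes "polytope P" "interior P \<noteq> {}"
  shows "finite (facet_halfspaces P)" 
    and "card (facet_halfspaces P) \<le> card {F. F facet_of P}"
proof -
  have img: "(\<lambda>H. P \<inter> bounding_hyperplane H) ` facet_halfspaces P \<subseteq> {F. F facet_of P}"
    by (auto simp: facet_halfspaces_def)
  note inj = inj_on_facet_halfspaces[OF assms(2)]
  note fin = finite_polytope_facets[OF assms(1)]
  show "finite (facet_halfspaces P)"
    using inj_on_finite[OF inj img fin] .
  show "card (facet_halfspaces P) \<le> card {F. F facet_of P}"
    using card_inj_on_le[OF inj img fin] .
qed

text \<open>In an irredundant representation of a polytope by halfspaces inside its affine hull, each
  halfspace cuts out a facet. Here the affine hull is the whole space, so these halfspaces alone
  determine the polytope.\<close>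

lemma Inter_facet_halfspaces_subset:
  fixes P :: "'a::euclidean_space set"
  assumes "polytope P" "interior P \<noteq> {}"
  shows "\<Inter>(facet_halfspaces P) \<subseteq> P"
proof -
  have hull: "affine hull P = UNIV"
    using assms(2) by (rule affine_hull_nonempty_interior)
  have "polyhedron P" using assms(1) by (rule polytope_imp_polyhedron)
  then obtain \<H> where \<H>: "finite \<H>" "P = affine hull P \<inter> \<Inter>\<H>"
    "\<forall>G\<in>\<H>. \<exists>a b. a \<noteq> 0 \<and> G = {x. a \<bullet> x \<le> b}"
    "\<forall>\<H>'. \<H>' \<subset> \<H> \<longrightarrow> P \<subset> affine hull P \<inter> \<Inter>\<H>'"
    unfolding polyhedron_Int_affine_minimal by blast
  then obtain a b where ab: "\<And>G. G \<in> \<H> \<Longrightarrow> a G \<noteq> 0 \<and> G = {x. a G \<bullet> x \<le> b G}"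
    by metis
  have facet_iff: "C facet_of P \<longleftrightarrow> (\<exists>G. G \<in> \<H> \<and> C = P \<inter> {x. a G \<bullet> x = b G})" for C
    using facet_of_polyhedron_explicit[of \<H> P a b C] \<H> ab by blast
  have "G \<in> facet_halfspaces P" if G: "G \<in> \<H>" for G
  proof -
    have eq: "G = {y. y \<bullet> (- a G) \<ge> - b G}" and nz: "- a G \<noteq> 0"
      using ab[OF G] by (auto simp: inner_commute)
    have "bounding_hyperplane G = {x. a G \<bullet> x = b G}"
      using bounding_hyperplane_halfspace[OF nz, of "- b G"] eq by (simp add: inner_commute)
    then have "(P \<inter> bounding_hyperplane G) facet_of P"
      using facet_iff G by auto
    moreover have "halfspace G"
      using eq nz unfolding halfspace_def by blast
    moreover have "P \<subseteq> G" using \<H>(2) G by blast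
    ultimately show ?thesis by (simp add: facet_halfspaces_def)
  qed
  then show ?thesis using \<H>(2) hull by auto
qed

section \<open>Admissible answers\<close>

text \<open>Farthest below the hyperplane means minimal for the functional \<open>h\<close> on all of \<open>B\<close>. Such a
  minimizer is automatically a boundary point: a nonzero linear functional has no minimum on an open set.\<close>

lemma hpO_Point_iff:
  fixes B :: "'a::euclidean_space set"
  assumes "compact B" "h \<noteq> 0"
  shows "hpO B {y. y \<bullet> h \<ge> M} (Point v) \<longleftrightarrow>
    v \<in> B \<and> v \<bullet> h < M \<and> (\<forall>y\<in>B. v \<bullet> h \<le> y \<bullet> h)"
proof -
  have "v \<in> frontier B" if "v \<in> B" "\<forall>y\<in>B. v \<bullet> h \<le> y \<bullet> h"
  proof -
    have "B \<subseteq> {y. h \<bullet> y \<ge> v \<bullet> h}"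
      using that by (auto simp: inner_commute)
    then have "interior B \<subseteq> {y. h \<bullet> y > v \<bullet> h}"
      using interior_mono interior_halfspace_ge[OF assms(2)] by blast
    then have "v \<notin> interior B" by (auto simp: inner_commute)
    with that(1) show ?thesis
      using closure_subset by (auto simp: frontier_def)
  qed
  moreover have "frontier B \<subseteq> B"
    using assms(1) by (simp add: compact_imp_closed frontier_subset_closed)
  moreover have "infdist y {x. x \<bullet> h = M} \<le> infdist v {x. x \<bullet> h = M} \<longleftrightarrow> v \<bullet> h \<le> y \<bullet> h"
    if "y \<bullet> h < M" "v \<bullet> h < M" for y
    using that assms(2) by (simp add: infdist_hyperplane divide_le_cancel)
  ultimately show ?thesis
    using assms(2)
    by (simp add: bounding_hyperplane_halfspace negative_side_halfspace) force
qed

lemma hpO_answer_exists: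
  fixes B :: "'a::euclidean_space set"
  assumes "compact B" "halfspace H"
  shows "\<exists>a. hpO B H a"
proof (cases "B \<subseteq> H")
  case True
  then have "hpO B H Inside" by simp
  then show ?thesis ..
next
  case False
  from assms(2) obtain h M where h: "h \<noteq> 0" "H = {y. y \<bullet> h \<ge> M}"
    unfolding halfspace_def by blast
  have "continuous_on B (\<lambda>y. y \<bullet> h)" by (intro continuous_intros)
  then obtain v where v: "v \<in> B" "\<forall>y\<in>B. v \<bullet> h \<le> y \<bullet> h"
    using continuous_attains_inf[of B "\<lambda>y. y \<bullet> h"] assms(1) False by auto
  from False obtain w where "w \<in> B" "w \<bullet> h < M"
    unfolding h(2) subset_iff by (auto simp: not_le)
  with v have "v \<bullet> h < M" by fastforce
  with v have "hpO B H (Point v)"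
    unfolding h(2) hpO_Point_iff[OF assms(1) h(1)] by blast
  then show ?thesis ..
qed

text \<open>The farthest points form a face of \<open>B\<close> lying below \<open>H\<close>; by Krein--Milman an answer, although
  it need not be a vertex itself, is a convex combination of the vertices of that face.\<close>

lemma answer_in_hull_of_negative_vertices:
  fixes B :: "'a::euclidean_space set"
  assumes "compact B" "convex B" "halfspace H" "hpO B H (Point v)"
  shows "v \<in> convex hull ({x. x extreme_point_of B} \<inter> negative_side H)"
proof -
  from assms(3) obtain h M where h: "h \<noteq> 0" "H = {y. y \<bullet> h \<ge> M}"
    and neg: "negative_side H = {y. y \<bullet> h < M}"
    using halfspaceE by metis
  have v: "v \<in> B" "v \<bullet> h < M" "\<forall>y\<in>B. v \<bullet> h \<le> y \<bullet> h"
    using assms(4) unfolding h(2) hpO_Point_iff[OF assms(1) h(1)] by auto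
  define F where "F = B \<inter> {x. x \<bullet> h = v \<bullet> h}"
  have face: "F face_of B"
    unfolding F_def using assms(2) v(3) by (intro supporting_hyperplane_face) auto
  have "F \<subseteq> negative_side H" using v(2) by (auto simp: F_def neg)
  have "v \<in> F" using v(1) by (simp add: F_def)
  also have "F = convex hull {x. x extreme_point_of F}"
    using face_of_imp_compact[OF assms(2,1) face] face_of_imp_convex[OF face]
    by (rule Krein_Milman_Minkowski)
  also have "\<dots> \<subseteq> convex hull ({x. x extreme_point_of B} \<inter> negative_side H)"
    using \<open>F \<subseteq> negative_side H\<close> by (intro hull_mono) (auto simp: extreme_point_of_face[OF face])
  finally show ?thesis .
qed

section \<open>Counting the oracle calls\<close>

text \<open>An oracle answer need not be a vertex of \<open>B\<close>, so counting the vertices inside the approximation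
  would not show progress; sets of vertices whose hull has been reached do.\<close>

definition met_vertex_sets :: "'a::euclidean_space set \<Rightarrow> 'a set \<Rightarrow> 'a set set" where
  "met_vertex_sets B P = {X. X \<subseteq> {x. x extreme_point_of B} \<and> convex hull X \<inter> P \<noteq> {}}"

definition progress :: "'a::euclidean_space set \<Rightarrow> 'a set \<times> 'a set set \<Rightarrow> nat" where
  "progress B st = card (met_vertex_sets B (fst st)) + card (snd st)"

text \<open>The invariant of a run. Its last part compares the flags with the facets of the limit
  rather than of the current approximation, so that one bound on the number of flags is valid
  throughout the run.\<close>

definition approximates ::
  "'a::euclidean_space set \<Rightarrow> 'a set \<Rightarrow> 'a set \<times> 'a set set \<Rightarrow> bool" where
  "approximates B S st \<longleftrightarrow> polytope (fst st) \<and> S \<subseteq> fst st \<and> fst st \<subseteq> convex hull (B \<union> S) \<and>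
     snd st \<subseteq> facet_halfspaces (convex hull (B \<union> S))"

lemma finite_vertices:
  fixes B :: "'a::euclidean_space set"
  assumes "polytope B"
  shows "finite {x. x extreme_point_of B}"
  using assms by (intro finite_polyhedron_extreme_points polytope_imp_polyhedron)

lemma met_vertex_sets_bound:
  fixes B :: "'a::euclidean_space set"
  assumes "polytope B"
  shows "finite (met_vertex_sets B P)"
    and "card (met_vertex_sets B P) \<le> 2 ^ card {x. x extreme_point_of B}"
proof -
  have sub: "met_vertex_sets B P \<subseteq> Pow {x. x extreme_point_of B}"
    by (auto simp: met_vertex_sets_def)
  note fin = finite_vertices[OF assms]
  show "finite (met_vertex_sets B P)"
    using sub fin by (meson finite_Pow_iff finite_subset)
  show "card (met_vertex_sets B P) \<le> 2 ^ card {x. x extreme_point_of B}"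
    using card_mono[OF _ sub] fin by (simp add: card_Pow)
qed

text \<open>The new member is the set of all vertices of \<open>B\<close> on the negative side of the query: their hull
  contains the added point, but stays on the negative side and hence away from \<open>P\<close>.\<close>

lemma met_vertex_sets_extend:
  fixes B :: "'a::euclidean_space set"
  assumes "polytope B" "H \<in> facet_halfspaces P" "hpO B H (Point v)"
  shows "met_vertex_sets B P \<subset> met_vertex_sets B (convex hull (insert v P))"
proof -
  let ?X = "{x. x extreme_point_of B} \<inter> negative_side H"
  have H: "halfspace H" "P \<subseteq> H" using assms(2) by (auto simp: facet_halfspaces_def)
  have sub: "insert v P \<subseteq> convex hull (insert v P)" by (rule hull_subset)
  then have "met_vertex_sets B P \<subseteq> met_vertex_sets B (convex hull (insert v P))"
    unfolding met_vertex_sets_def by blast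
  moreover have "?X \<in> met_vertex_sets B (convex hull (insert v P))"
    using answer_in_hull_of_negative_vertices[OF polytope_imp_compact[OF assms(1)]
        polytope_imp_convex[OF assms(1)] H(1) assms(3)] sub
    unfolding met_vertex_sets_def by blast
  moreover have "?X \<notin> met_vertex_sets B P"
  proof -
    obtain h M where neg: "negative_side H = {y. y \<bullet> h < M}" using halfspaceE[OF H(1)] by metis
    have "convex (negative_side H)"
      using convex_halfspace_lt[of h M] by (simp add: neg inner_commute)
    then have "convex hull ?X \<subseteq> negative_side H"
      by (intro hull_minimal) auto
    then show ?thesis
      using H(2) by (auto simp: met_vertex_sets_def negative_side_def)
  qed
  ultimately show ?thesis by blast
qed

lemma approximates_init:
  assumes "polytope S"
  shows "approximates B S (S, {})"
  using assms hull_subset[of "B \<union> S" convex] by (auto simp: approximates_def)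

lemma polytope_convex_hull_insert:
  assumes "polytope P"
  shows "polytope (convex hull (insert v P))"
proof -
  from assms obtain V where "finite V" "P = convex hull V" by (auto simp: polytope_def)
  then have "convex hull (insert v P) = convex hull (insert v V)"
    by (simp add: hull_insert[of convex v V, symmetric])
  with \<open>finite V\<close> show ?thesis by (simp add: polytope_convex_hull)
qed

lemma step_approximates:
  fixes B S :: "'a::euclidean_space set"
  assumes "step B st st'" "approximates B S st" "compact B" "interior S \<noteq> {}"
  shows "approximates B S st'"
  using assms(1)
proof cases
  case (mark_final H P Fin)
  have P: "polytope P" "S \<subseteq> P" "P \<subseteq> convex hull (B \<union> S)"
    and Fin: "Fin \<subseteq> facet_halfspaces (convex hull (B \<union> S))"
    using assms(2) mark_final(1) by (auto simp: approximates_def)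
  have H: "halfspace H" "P \<subseteq> H" using mark_final by (auto simp: facet_halfspaces_def)
  then have "convex H"
    using convex_halfspace_ge by (force simp: halfspace_def inner_commute)
  moreover have "B \<subseteq> H" using mark_final(5) by simp
  ultimately have "convex hull (B \<union> S) \<subseteq> H"
    using P(2) H(2) by (intro hull_minimal) auto
  moreover have "interior P \<noteq> {}" using interior_mono[OF P(2)] assms(4) by blast
  ultimately have "H \<in> facet_halfspaces (convex hull (B \<union> S))"
    using facet_halfspaces_mono[OF mark_final(3) P(3)] convex_convex_hull by blast
  then show ?thesis using P Fin mark_final(2) by (auto simp: approximates_def)
next
  case (extend H P Fin v)
  have P: "polytope P" "S \<subseteq> P" "P \<subseteq> convex hull (B \<union> S)"
    and Fin: "Fin \<subseteq> facet_halfspaces (convex hull (B \<union> S))"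
    using assms(2) extend(1) by (auto simp: approximates_def)
  have "v \<in> frontier B" using extend by simp
  then have "v \<in> B"
    using assms(3) compact_imp_closed frontier_subset_closed by blast
  then have "v \<in> convex hull (B \<union> S)" using hull_subset[of "B \<union> S" convex] by blast
  then have "convex hull (insert v P) \<subseteq> convex hull (B \<union> S)"
    using P(3) by (intro hull_minimal) auto
  moreover have "S \<subseteq> convex hull (insert v P)"
    using P(2) hull_subset[of "insert v P" convex] by blast
  ultimately show ?thesis
    using Fin P(1) extend(2) by (auto simp: approximates_def polytope_convex_hull_insert)
qed

lemma polytope_convex_hull_Un:
  assumes "polytope B" "polytope S"
  shows "polytope (convex hull (B \<union> S))"
proof -
  from assms obtain V W where "finite V" "B = convex hull V" "finite W" "S = convex hull W"
    by (auto simp: polytope_def)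
  moreover have "convex hull (convex hull V \<union> convex hull W) = convex hull (V \<union> W)"
    by (simp add: hull_Un_left[symmetric] hull_Un_right[symmetric])
  ultimately show ?thesis by (simp add: polytope_convex_hull)
qed

lemma interior_convex_hull_Un:
  assumes "interior S \<noteq> {}"
  shows "interior (convex hull (B \<union> S)) \<noteq> {}"
  using assms interior_mono[of S "convex hull (B \<union> S)"] hull_subset[of "B \<union> S" convex] by blast

lemma step_progress:
  fixes B S :: "'a::euclidean_space set"
  assumes "step B st st'" "approximates B S st"
    and "polytope B" "polytope S" "interior S \<noteq> {}"
  shows "progress B st < progress B st'"
  using assms(1)
proof cases
  case (mark_final H P Fin)
  have "Fin \<subseteq> facet_halfspaces (convex hull (B \<union> S))"
    using assms(2) mark_final(1) by (simp add: approximates_def)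
  then have "finite Fin"
    using finite_facet_halfspaces(1)[OF polytope_convex_hull_Un interior_convex_hull_Un] assms
    by (blast intro: finite_subset)
  then show ?thesis using mark_final(1,2,4) by (simp add: progress_def)
next
  case (extend H P Fin v)
  have "card (met_vertex_sets B P) < card (met_vertex_sets B (convex hull (insert v P)))"
    using met_vertex_sets_bound(1)[OF assms(3)] met_vertex_sets_extend[OF assms(3) extend(3,5)]
    by (rule psubset_card_mono)
  then show ?thesis using extend(1,2) by (simp add: progress_def)
qed

lemma progress_bound:
  fixes B S :: "'a::euclidean_space set"
  assumes "approximates B S st" "polytope B" "polytope S" "interior S \<noteq> {}"
  shows "progress B st
    \<le> 2 ^ card {x. x extreme_point_of B} + card {F. F facet_of convex hull (B \<union> S)}"
proof -
  note hull = polytope_convex_hull_Un[OF assms(2,3)] interior_convex_hull_Un[OF assms(4), of B]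
  have "card (snd st) \<le> card (facet_halfspaces (convex hull (B \<union> S)))"
    using assms(1) finite_facet_halfspaces(1)[OF hull]
    by (intro card_mono) (auto simp: approximates_def)
  also have "\<dots> \<le> card {F. F facet_of convex hull (B \<union> S)}"
    by (rule finite_facet_halfspaces(2)[OF hull])
  finally show ?thesis
    using met_vertex_sets_bound(2)[OF assms(2), of "fst st"] by (simp add: progress_def)
qed

lemma run_approximates_progress:
  fixes B S :: "'a::euclidean_space set"
  assumes "(step B ^^ n) (S, {}) st" "polytope B" "polytope S" "interior S \<noteq> {}"
  shows "approximates B S st \<and> n \<le> progress B st"
  using assms(1)
proof (induction n arbitrary: st)
  case 0
  then show ?case using approximates_init[OF assms(3)] by auto
next
  case (Suc n)
  then obtain st' where "(step B ^^ n) (S, {}) st'" and st': "step B st' st" by auto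
  with Suc.IH have inv: "approximates B S st'" and "n \<le> progress B st'" by auto
  moreover have "approximates B S st"
    using step_approximates[OF st' inv polytope_imp_compact[OF assms(2)] assms(4)] .
  moreover have "progress B st' < progress B st"
    using step_progress[OF st' inv assms(2-4)] .
  ultimately show ?case by simp
qed

text \<open>This bounds all runs, stopped or not, and so excludes infinite ones too.\<close>

lemma run_length_bound:
  fixes B S :: "'a::euclidean_space set"
  assumes "(step B ^^ n) (S, {}) st" "polytope B" "polytope S" "interior S \<noteq> {}"
  shows "n \<le> 2 ^ card {x. x extreme_point_of B} + card {F. F facet_of convex hull (B \<union> S)}"
  using run_approximates_progress[OF assms] progress_bound[OF _ assms(2-4)] by (meson le_trans)

section \<open>Termination and the result\<close>

text \<open>A run cannot get stuck, because the oracle has an admissible answer to every query.\<close>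

lemma step_if_not_stopped:
  fixes B :: "'a::euclidean_space set"
  assumes "compact B" "\<not> stopped st"
  shows "\<exists>st'. step B st st'"
proof -
  obtain P Fin where st: "st = (P, Fin)" by fastforce
  from assms(2) obtain H where H: "H \<in> facet_halfspaces P" "H \<notin> Fin"
    by (auto simp: stopped_def st)
  then have "halfspace H" by (simp add: facet_halfspaces_def)
  then obtain a where "hpO B H a" using hpO_answer_exists[OF assms(1)] by blast
  with H show ?thesis unfolding st by (cases a) (blast intro: step.intros)+
qed

text \<open>Every facet halfspace of \<open>R\<close> is flagged and therefore contains \<open>B\<close>; intersecting them
  gives \<open>B \<subseteq> R\<close>.\<close>

lemma stopped_eq_hull:
  fixes B S :: "'a::euclidean_space set"
  assumes "approximates B S (R, Fin)" "stopped (R, Fin)" "interior S \<noteq> {}"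
  shows "R = convex hull (B \<union> S)"
proof
  have R: "polytope R" "S \<subseteq> R" and Fin: "Fin \<subseteq> facet_halfspaces (convex hull (B \<union> S))"
    using assms(1) by (auto simp: approximates_def)
  show "R \<subseteq> convex hull (B \<union> S)" using assms(1) by (simp add: approximates_def)
  have "B \<subseteq> convex hull (B \<union> S)" using hull_subset[of "B \<union> S" convex] by blast
  also have "\<dots> \<subseteq> \<Inter>(facet_halfspaces R)"
  proof (rule Inter_greatest)
    fix H assume "H \<in> facet_halfspaces R"
    then have "H \<in> facet_halfspaces (convex hull (B \<union> S))"
      using Fin assms(2) by (auto simp: stopped_def)
    then show "convex hull (B \<union> S) \<subseteq> H"
      unfolding facet_halfspaces_def by blast
  qed
  also have "\<dots> \<subseteq> R"
    by (rule Inter_facet_halfspaces_subset[OF R(1)]) (use interior_mono[OF R(2)] assms(3) in blast)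
  finally show "convex hull (B \<union> S) \<subseteq> R"
    using R(2) by (intro hull_minimal polytope_imp_convex[OF R(1)]) simp
qed

theorem theorem8:
  fixes S B :: "(real ^ 'p) set"
  assumes "polytope S" and "interior S \<noteq> {}"
    and "polytope B" and "interior B \<noteq> {}"
  shows "terminates B S \<and>
    (\<forall>n R Fin. (step B ^^ n) (S, {}) (R, Fin) \<and> stopped (R, Fin) \<longrightarrow>
       R = convex hull (B \<union> S) \<and>
       n \<le> 2 ^ card {x. x extreme_point_of B} + card {F. F facet_of R})"
proof (intro conjI allI impI)
  show "terminates B S"
    unfolding terminates_def
  proof (intro conjI notI allI impI)
    let ?N = "2 ^ card {x. x extreme_point_of B} + card {F. F facet_of convex hull (B \<union> S)}"
    assume "\<exists>\<sigma>. \<sigma> 0 = (S, {}) \<and> (\<forall>i. step B (\<sigma> i) (\<sigma> (Suc i)))"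
    then obtain \<sigma> where "\<sigma> 0 = (S, {})" "\<And>i. step B (\<sigma> i) (\<sigma> (Suc i))" by blast
    then have "(step B ^^ n) (S, {}) (\<sigma> n)" for n
      by (induction n) auto
    then have "Suc ?N \<le> ?N"
      using run_length_bound assms by blast
    then show False by simp
  next
    fix st assume "(step B)\<^sup>*\<^sup>* (S, {}) st \<and> \<not> stopped st"
    then show "\<exists>st'. step B st st'"
      using step_if_not_stopped polytope_imp_compact[OF assms(3)] by blast
  qed
next
  fix n R Fin
  assume run: "(step B ^^ n) (S, {}) (R, Fin) \<and> stopped (R, Fin)"
  then show R: "R = convex hull (B \<union> S)"
    using run_approximates_progress[of n B S "(R, Fin)"] stopped_eq_hull assms by blast
  show "n \<le> 2 ^ card {x. x extreme_point_of B} + card {F. F facet_of R}"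
    unfolding R using run run_length_bound assms by blast
qed

end
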